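(* For all integers $n\ge 0$ and $h\ge 0$, $|\mathcal{B}_{n,h}|=|\mathcal{D}_{n,h}|$, where $\mathcal{B}_{n,h}$ is the set of full binary trees with $n$ internal vertices and refined Horton--Strahler number $h$, and $\mathcal{D}_{n,h}$ is the set of Dyck paths of length $2n$ with height $h$.
   Context: Let $\mathcal{U}=\{1,2\}^*$ be the set of finite words over $\{1,2\}$ (including the empty word $\emptyset$); $uv$ or $u\star v$ denotes concatenation, $uV=\{uv:v\in V\}$. A binary tree is a finite set $\mathrm{t}\subset\mathcal{U}$ containing $\emptyset$ and closed under taking prefixes (if $u_1\dots u_\ell\in\mathrm{t}$ then $u_1\dots u_{\ell-1}\in\mathrm{t}$). A vertex $v$ is internal if $v1\in\mathrm{t}$ or $v2\in\mathrm{t}$. The tree is full if for all $u\in\mathrm{t}$, $u1\in\mathrm{t}\iff u2\in\mathrm{t}$. Let $\preceq_{\mathrm{lex}}$ be the lexicographic order on $\mathcal{U}$ and $u\wedge v$ the longest common prefix of $u,v$. An embedding of a tree $\mathrm{t}$ in a tree $\mathrm{t}'$ is an injective map $\varphi:\mathrm{t}\to\mathrm{t}'$ that is strictly increasing for $\preceq_{\mathrm{lex}}$ and satisfies $\varphi(u\wedge v)=\varphi(u)\wedge\varphi(v)$ for all $u,v\in\mathrm{t}$. Define trees $\tau_0=\{\emptyset\}$, $\tau_1=\{\emptyset,1,2\}$, and for $m\ge1$: $\tau_{2m}=\{\emptyset\}\cup 1\tau_m\cup 2\tau_{m-1}$, $\tau_{2m+1}=\{\emptyset\}\cup 1\tau_m\cup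 2\tau_m$. The refined Horton--Strahler number of a binary tree $\mathrm{t}$ is $\mathcal{S}(\mathrm{t})=\max\{r:\tau_r\text{ can be embedded in }\mathrm{t}\}$. A Dyck path of length $2n$ is a function $\mathrm{d}:\{0,\dots,2n\}\to\mathbb{Z}_{\ge0}$ with $\mathrm{d}(0)=\mathrm{d}(2n)=0$ and $|\mathrm{d}(i)-\mathrm{d}(i-1)|=1$ for $1\le i\le 2n$; its height is $\|\mathrm{d}\|=\max_i\mathrm{d}(i)$. *)

theory Defs
  imports Main "HOL-Library.FuncSet" "HOL-Library.Sublist"
begin

type_synonym word = "nat list"

definition words :: "word set" where
  "words = lists {1, 2}"

definition binary_tree :: "word set \<Rightarrow> bool" where
  "binary_tree t \<longleftrightarrow>
     t \<subseteq> words \<and> finite t \<and> [] \<in> t \<and> (\<forall>u x. u @ [x] \<in> t \<longrightarrow> u \<in> t)"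

definition internal :: "word set \<Rightarrow> word \<Rightarrow> bool" where
  "internal t v \<longleftrightarrow> v \<in> t \<and> (v @ [1] \<in> t \<or> v @ [2] \<in> t)"

definition full :: "word set \<Rightarrow> bool" where
  "full t \<longleftrightarrow> (\<forall>u\<in>t. u @ [1] \<in> t \<longleftrightarrow> u @ [2] \<in> t)"

text \<open>The strict lexicographic order; a proper prefix of a word is smaller than the word.\<close>

definition lex_less :: "word \<Rightarrow> word \<Rightarrow> bool" where
  "lex_less u v \<longleftrightarrow> (u, v) \<in> lexord less_than"

definition embedding :: "(word \<Rightarrow> word) \<Rightarrow> word set \<Rightarrow> word set \<Rightarrow> bool" where
  "embedding \<phi> t t' \<longleftrightarrow>
     \<phi> \<in> t \<rightarrow> t' \<and> inj_on \<phi> t \<and>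
     (\<forall>u\<in>t. \<forall>v\<in>t. lex_less u v \<longrightarrow> lex_less (\<phi> u) (\<phi> v)) \<and>
     (\<forall>u\<in>t. \<forall>v\<in>t.
        \<phi> (longest_common_prefix u v) = longest_common_prefix (\<phi> u) (\<phi> v))"

definition embeddable :: "word set \<Rightarrow> word set \<Rightarrow> bool" where
  "embeddable t t' \<longleftrightarrow> (\<exists>\<phi>. embedding \<phi> t t')"

text \<open>
  The two recursive cases are merged into one equation;
  \<open>tau_even\<close> and \<open>tau_odd\<close> below state them separately.
\<close>

fun tau :: "nat \<Rightarrow> word set" where
  "tau r =
     (if r = 0 then {[]}
      else if r = 1 then {[], [1], [2]}
      else {[]} \<union> (#) 1 ` tau (r div 2) \<union> (#) 2 ` tau ((r - 1) div 2))"

declare tau.simps [simp del]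

lemma tau_0: "tau 0 = {[]}"
  by (simp add: tau.simps)

lemma tau_1: "tau 1 = {[], [1], [2]}"
  by (simp add: tau.simps)

lemma tau_even:
  assumes "m \<ge> 1"
  shows "tau (2 * m) = {[]} \<union> (#) 1 ` tau m \<union> (#) 2 ` tau (m - 1)"
proof -
  have "(2 * m - 1) div 2 = m - 1"
    using assms by linarith
  then show ?thesis
    using assms by (subst tau.simps) simp
qed

lemma tau_odd:
  assumes "m \<ge> 1"
  shows "tau (2 * m + 1) = {[]} \<union> (#) 1 ` tau m \<union> (#) 2 ` tau m"
  using assms by (subst tau.simps) simp

text \<open>
  For a binary tree \<open>t\<close> the set below contains \<open>0\<close>, and it is finite because \<open>tau r\<close>
  has \<open>2 * r + 1\<close> vertices, so the maximum is a genuine one.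
\<close>

definition horton_strahler :: "word set \<Rightarrow> nat" where
  "horton_strahler t = Max {r. embeddable (tau r) t}"

definition full_binary_trees :: "nat \<Rightarrow> nat \<Rightarrow> word set set" where
  "full_binary_trees n h =
     {t. binary_tree t \<and> full t \<and> card {v. internal t v} = n \<and> horton_strahler t = h}"

text \<open>
  Extensionality (\<open>\<rightarrow>\<^sub>E\<close>) makes each path on \<open>{0..2 * n}\<close> be represented by exactly one function.
\<close>

definition dyck_path :: "nat \<Rightarrow> (nat \<Rightarrow> nat) \<Rightarrow> bool" where
  "dyck_path n d \<longleftrightarrow>
     d \<in> {0..2 * n} \<rightarrow>\<^sub>E UNIV \<and> d 0 = 0 \<and> d (2 * n) = 0 \<and>
     (\<forall>i\<in>{1..2 * n}. \<bar>int (d i) - int (d (i - 1))\<bar> = 1)"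

definition height :: "nat \<Rightarrow> (nat \<Rightarrow> nat) \<Rightarrow> nat" where
  "height n d = Max (d ` {0..2 * n})"

definition dyck_paths :: "nat \<Rightarrow> nat \<Rightarrow> (nat \<Rightarrow> nat) set" where
  "dyck_paths n h = {d. dyck_path n d \<and> height n d = h}"

end

theory Submission
  imports Defs "HOL-Computational_Algebra.Formal_Power_Series"
begin

text \<open>
  A root-branching embedding of \<open>\<tau>\<^sub>r\<close> sends the left and right subtrees of \<open>\<tau>\<^sub>r\<close> into those of the
  target, so a full binary tree with subtrees of numbers \<open>a\<close> and \<open>b\<close> has number
  \<open>max (max a b) (min (2 * a + 1) (2 * b + 2))\<close>. Let \<open>T\<^sub>h\<close> be the generating function of the trees
  with number less than \<open>h > 0\<close>, and let \<open>p = h div 2\<close>, \<open>q = (h - 1) div 2\<close>. Then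
  \<open>T\<^sub>h = 1 + z (T\<^sub>p T\<^sub>h + T\<^sub>h T\<^sub>q - T\<^sub>p T\<^sub>q)\<close> and \<open>p + q = h - 1\<close>. With the Fibonacci polynomials
  \<open>F\<^sub>0 = 0\<close>, \<open>F\<^sub>1 = 1\<close>, \<open>F\<^bsub>n+2\<^esub> = F\<^bsub>n+1\<^esub> - z F\<^sub>n\<close>, their addition formula yields
  \<open>T\<^sub>h = F\<^sub>h / F\<^bsub>h+1\<^esub>\<close> by strong induction on \<open>h\<close>; this is also the generating function of the Dyck
  paths of height less than \<open>h\<close>.
\<close>

unbundle fps_syntax

section \<open>Embeddings into a tree with two branches\<close>

definition join :: "word set \<Rightarrow> word set \<Rightarrow> word set" where
  "join s t = insert [] ((#) 1 ` s \<union> (#) 2 ` t)"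

lemma Nil_in_join [simp]: "[] \<in> join s t"
  by (simp add: join_def)

lemma Cons_in_join [simp]: "x # u \<in> join s t \<longleftrightarrow> x = 1 \<and> u \<in> s \<or> x = 2 \<and> u \<in> t"
  by (auto simp: join_def)

lemma in_join_cases:
  assumes "w \<in> join s t"
  obtains "w = []" | u where "w = 1 # u" "u \<in> s" | u where "w = 2 # u" "u \<in> t"
  using assms by (auto simp: join_def)

text \<open>One recursion covers every \<open>r > 0\<close>: for \<open>r = 1\<close> both indices
  are \<open>0\<close>, and joining two singletons gives \<open>tau 1\<close>.\<close>

lemma tau_join: "r > 0 \<Longrightarrow> tau r = join (tau (r div 2)) (tau ((r - 1) div 2))"
  using tau_1 by (cases "r = 1") (auto simp: join_def tau_0 tau.simps [of r])

lemma Nil_in_tau: "[] \<in> tau r"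
  by (cases "r = 0") (simp_all add: tau_0 tau_join)

lemma embeddingI:
  assumes "\<And>u. u \<in> s \<Longrightarrow> \<phi> u \<in> t" "inj_on \<phi> s"
    and "\<And>u v. u \<in> s \<Longrightarrow> v \<in> s \<Longrightarrow> lex_less u v \<Longrightarrow> lex_less (\<phi> u) (\<phi> v)"
    and "\<And>u v. u \<in> s \<Longrightarrow> v \<in> s \<Longrightarrow>
           \<phi> (longest_common_prefix u v) = longest_common_prefix (\<phi> u) (\<phi> v)"
  shows "embedding \<phi> s t"
  using assms by (auto simp: embedding_def)

lemma embeddingD:
  assumes "embedding \<phi> s t"
  shows "u \<in> s \<Longrightarrow> \<phi> u \<in> t" "inj_on \<phi> s"
    and "u \<in> s \<Longrightarrow> v \<in> s \<Longrightarrow> lex_less u v \<Longrightarrow> lex_less (\<phi> u) (\<phi> v)"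
    and "u \<in> s \<Longrightarrow> v \<in> s \<Longrightarrow>
           \<phi> (longest_common_prefix u v) = longest_common_prefix (\<phi> u) (\<phi> v)"
  using assms by (auto simp: embedding_def)

lemma lex_less_Cons [simp]: "lex_less (x # u) (y # v) \<longleftrightarrow> x < y \<or> x = y \<and> lex_less u v"
  by (auto simp: lex_less_def)

lemma lex_less_Nil [simp]: "lex_less [] v \<longleftrightarrow> v \<noteq> []" "\<not> lex_less u []"
  by (auto simp: lex_less_def neq_Nil_conv)

lemma longest_common_prefix_eq_left:
  assumes "longest_common_prefix (x # u) v = x # u"
  obtains w where "v = x # w"
  using assms by (cases v) (auto split: if_splits)

text \<open>Here \<open>f\<close> is to be the identity or the prepending of a letter. When all
  images lie in one branch of the target, dropping their common first letter keeps order, meets and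
  injectivity.\<close>

lemma embedding_restrict_branch:
  assumes "embedding \<phi> s t'" and "\<And>u. u \<in> r \<Longrightarrow> f u \<in> s"
    and "inj_on f r" and "\<And>u v. lex_less u v \<Longrightarrow> lex_less (f u) (f v)"
    and "\<And>u v. longest_common_prefix (f u) (f v) = f (longest_common_prefix u v)"
    and hd: "\<And>u. u \<in> r \<Longrightarrow> \<exists>w\<in>t. \<phi> (f u) = x # w"
  shows "embedding (\<lambda>u. tl (\<phi> (f u))) r t"
proof -
  note e = embeddingD [OF assms(1)]
  have eq: "\<phi> (f u) = x # tl (\<phi> (f u))" if "u \<in> r" for u
    using hd [OF that] by auto
  show ?thesis
  proof (rule embeddingI)
    show "tl (\<phi> (f u)) \<in> t" if "u \<in> r" for u
      using hd [OF that] by auto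
    show "inj_on (\<lambda>u. tl (\<phi> (f u))) r"
      by (intro inj_onI) (metis assms(2,3) e(2) eq inj_onD)
  next
    fix u v assume uv: "u \<in> r" "v \<in> r" "lex_less u v"
    then have "lex_less (\<phi> (f u)) (\<phi> (f v))"
      using e(3) assms(2,4) by blast
    then show "lex_less (tl (\<phi> (f u))) (tl (\<phi> (f v)))"
      using eq [OF uv(1)] eq [OF uv(2)] by (metis lex_less_Cons less_irrefl)
  next
    fix u v assume uv: "u \<in> r" "v \<in> r"
    have "\<phi> (f (longest_common_prefix u v)) = longest_common_prefix (\<phi> (f u)) (\<phi> (f v))"
      using e(4) [of "f u" "f v"] uv assms(2,5) by simp
    also have "\<dots> = x # longest_common_prefix (tl (\<phi> (f u))) (tl (\<phi> (f v)))"
      by (subst eq [OF uv(1)], subst eq [OF uv(2)]) simp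
    finally show "tl (\<phi> (f (longest_common_prefix u v))) =
        longest_common_prefix (tl (\<phi> (f u))) (tl (\<phi> (f v)))"
      by simp
  qed
qed

lemma embedding_Cons:
  assumes "embedding \<phi> s t" and "\<And>w. w \<in> t \<Longrightarrow> x # w \<in> t'"
  shows "embedding (\<lambda>u. x # \<phi> u) s t'"
  by (rule embeddingI)
    (use embeddingD [OF assms(1)] assms(2) in \<open>auto simp: inj_on_def\<close>)

text \<open>Words in different branches have meet \<open>[]\<close>, and their first letters, which
  are kept, decide their order.\<close>

lemma embedding_join:
  assumes "embedding \<phi> s1 t1" "embedding \<psi> s2 t2"
  shows "embedding
    (\<lambda>w. case w of [] \<Rightarrow> [] | x # u \<Rightarrow> x # (if x = 1 then \<phi> u else \<psi> u)) (join s1 s2) (join t1 t2)"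
proof -
  note e = embeddingD [OF assms(1)] and e' = embeddingD [OF assms(2)]
  show ?thesis
    apply (rule embeddingI)
    subgoal by (elim in_join_cases) (auto simp: e e')
    subgoal by (intro inj_onI, elim in_join_cases) (auto dest: inj_onD [OF e(2)] inj_onD [OF e'(2)])
    subgoal by (elim in_join_cases) (auto simp: e e')
    subgoal by (elim in_join_cases) (auto simp: e e')
    done
qed

text \<open>The image of the root decides: a nonempty \<open>\<phi> []\<close> confines the
  embedding to one branch, an empty one splits it into embeddings of the two branches.\<close>

lemma embeddable_join:
  assumes "[] \<in> s1" "[] \<in> s2"
  shows "embeddable (join s1 s2) (join t1 t2) \<longleftrightarrow>
    embeddable (join s1 s2) t1 \<or> embeddable (join s1 s2) t2 \<or> embeddable s1 t1 \<and> embeddable s2 t2"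
    (is "?L \<longleftrightarrow> ?R")
proof
  assume ?R
  then consider \<phi> where "embedding \<phi> (join s1 s2) t1" | \<phi> where "embedding \<phi> (join s1 s2) t2"
    | \<phi> \<psi> where "embedding \<phi> s1 t1" "embedding \<psi> s2 t2"
    unfolding embeddable_def by blast
  then show ?L
  proof cases
    case (1 \<phi>)
    then have "embedding (\<lambda>u. 1 # \<phi> u) (join s1 s2) (join t1 t2)"
      by (rule embedding_Cons) simp
    then show ?thesis
      unfolding embeddable_def by blast
  next
    case (2 \<phi>)
    then have "embedding (\<lambda>u. 2 # \<phi> u) (join s1 s2) (join t1 t2)"
      by (rule embedding_Cons) simp
    then show ?thesis
      unfolding embeddable_def by blast
  next
    case (3 \<phi> \<psi>)
    then show ?thesis
      unfolding embeddable_def by (blast intro: embedding_join)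
  qed
next
  assume ?L
  then obtain \<phi> where \<phi>: "embedding \<phi> (join s1 s2) (join t1 t2)"
    by (auto simp: embeddable_def)
  note e = embeddingD [OF \<phi>]
  show ?R
  proof (cases "\<phi> []")
    case (Cons x w)
    \<comment> \<open>The meet of the root with any \<open>u\<close> is the root, so
      \<open>\<phi> []\<close> is a prefix of every image.\<close>
    have *: "\<exists>w. \<phi> u = x # w" if "u \<in> join s1 s2" for u
    proof -
      have "longest_common_prefix (\<phi> []) (\<phi> u) = \<phi> []"
        using e(4) [of "[]" u] that by simp
      then show ?thesis
        using Cons by (metis longest_common_prefix_eq_left)
    qed
    have x: "x = 1 \<or> x = 2"
      using e(1) [of "[]"] Cons by auto
    have "embedding (\<lambda>u. tl (\<phi> u)) (join s1 s2) (if x = 1 then t1 else t2)"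
    proof (rule embedding_restrict_branch [where f = "\<lambda>u. u", OF \<phi>])
      show "\<exists>w \<in> if x = 1 then t1 else t2. \<phi> u = x # w" if "u \<in> join s1 s2" for u
        using *[OF that] e(1) [OF that] x by auto
    qed auto
    then show ?thesis
      unfolding embeddable_def by (auto split: if_splits)
  next
    case Nil
    have "lex_less (\<phi> [1]) (\<phi> [2])"
      by (rule e(3)) (use assms in auto)
    moreover have "\<phi> [1] \<noteq> \<phi> []" "\<phi> [2] \<noteq> \<phi> []"
      using assms inj_onD [OF e(2), of "[1]" "[]"] inj_onD [OF e(2), of "[2]" "[]"] by auto
    moreover have "longest_common_prefix (\<phi> [1]) (\<phi> [2]) = []"
      using e(4) [of "[1]" "[2]"] assms Nil by simp
    moreover have "\<phi> [1] \<in> join t1 t2" "\<phi> [2] \<in> join t1 t2"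
      using assms e(1) by auto
    \<comment> \<open>Nonempty words with meet \<open>[]\<close> start with different letters; the
      order forces these to be \<open>1\<close> and then \<open>2\<close>.\<close>
    ultimately obtain v1 v2 where v: "\<phi> [1] = 1 # v1" "\<phi> [2] = 2 # v2"
      using Nil by (elim in_join_cases) auto
    \<comment> \<open>Since \<open>[1]\<close> is the meet of \<open>[1]\<close> and
      \<open>1 # u\<close>, the image of \<open>[1]\<close> is a prefix of that of
      \<open>1 # u\<close>.\<close>
    have 1: "\<exists>w\<in>t1. \<phi> (1 # u) = 1 # w" if "u \<in> s1" for u
    proof -
      have "longest_common_prefix (\<phi> [1]) (\<phi> (1 # u)) = \<phi> [1]"
        using e(4) [of "[1]" "1 # u"] assms that by simp
      then obtain w where "\<phi> (1 # u) = 1 # w"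
        using v by (metis longest_common_prefix_eq_left)
      then show ?thesis
        using e(1) [of "1 # u"] that by auto
    qed
    have 2: "\<exists>w\<in>t2. \<phi> (2 # u) = 2 # w" if "u \<in> s2" for u
    proof -
      have "longest_common_prefix (\<phi> [2]) (\<phi> (2 # u)) = \<phi> [2]"
        using e(4) [of "[2]" "2 # u"] assms that by simp
      then obtain w where "\<phi> (2 # u) = 2 # w"
        using v by (metis longest_common_prefix_eq_left)
      then show ?thesis
        using e(1) [of "2 # u"] that by auto
    qed
    have "embedding (\<lambda>u. tl (\<phi> (1 # u))) s1 t1"
      by (rule embedding_restrict_branch [OF \<phi> _ _ _ _ 1]) auto
    moreover have "embedding (\<lambda>u. tl (\<phi> (2 # u))) s2 t2"
      by (rule embedding_restrict_branch [OF \<phi> _ _ _ _ 2]) auto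
    ultimately show ?thesis
      unfolding embeddable_def by blast
  qed
qed

section \<open>Full binary trees\<close>

datatype shape = Tip | Fork shape shape

fun vertices :: "shape \<Rightarrow> word set" where
  "vertices Tip = {[]}"
| "vertices (Fork a b) = join (vertices a) (vertices b)"

text \<open>The condition \<open>r div 2 \<le> a\<close> means \<open>r \<le> 2 * a + 1\<close>, and
  \<open>(r - 1) div 2 \<le> b\<close> means \<open>r \<le> 2 * b + 2\<close>. The
  \<open>min\<close> is thus the largest \<open>r\<close> for which \<open>tau r\<close> embeds with
  root sent to root.\<close>

fun hs :: "shape \<Rightarrow> nat" where
  "hs Tip = 0"
| "hs (Fork a b) = max (max (hs a) (hs b)) (min (2 * hs a + 1) (2 * hs b + 2))"

lemma Nil_in_vertices [simp]: "[] \<in> vertices t"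
  by (cases t) auto

lemma embeddable_singleton: "[] \<in> t \<Longrightarrow> embeddable {[]} t"
  unfolding embeddable_def by (rule exI [of _ "\<lambda>_. []"]) (auto intro!: embeddingI)

lemma not_embeddable_join_singleton:
  assumes "[] \<in> s"
  shows "\<not> embeddable (join s s') {[]}"
proof
  assume "embeddable (join s s') {[]}"
  then obtain \<phi> where "embedding \<phi> (join s s') {[]}"
    by (auto simp: embeddable_def)
  note e = embeddingD [OF this]
  show False
    using e(1) [of "[]"] e(1) [of "[1]"] inj_onD [OF e(2), of "[]" "[1]"] assms by auto
qed

lemma embeddable_tau_iff: "embeddable (tau r) (vertices t) \<longleftrightarrow> r \<le> hs t"
proof (induction t arbitrary: r)
  case Tip
  then show ?case
    by (cases "r = 0")
      (auto simp: tau_0 tau_join embeddable_singleton not_embeddable_join_singleton Nil_in_tau)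
next
  case (Fork a b)
  show ?case
  proof (cases "r = 0")
    case True
    then show ?thesis
      by (simp add: tau_0 embeddable_singleton)
  next
    case False
    then have r: "tau r = join (tau (r div 2)) (tau ((r - 1) div 2))"
      by (simp add: tau_join)
    have "embeddable (tau r) (vertices (Fork a b)) \<longleftrightarrow>
        r \<le> hs a \<or> r \<le> hs b \<or> r div 2 \<le> hs a \<and> (r - 1) div 2 \<le> hs b"
      \<comment> \<open>\<open>tau r\<close> is unfolded to split the embedding, then folded back
        where it goes into a single branch, so that the induction hypothesis applies with the same
        \<open>r\<close>.\<close>
      unfolding vertices.simps r embeddable_join [OF Nil_in_tau Nil_in_tau]
      unfolding r [symmetric] Fork.IH ..
    also have "\<dots> \<longleftrightarrow> r \<le> hs (Fork a b)"
      using False by auto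
    finally show ?thesis .
  qed
qed

lemma horton_strahler_vertices: "horton_strahler (vertices t) = hs t"
proof -
  have "{r. embeddable (tau r) (vertices t)} = {..hs t}"
    by (auto simp: embeddable_tau_iff)
  then show ?thesis
    by (simp add: horton_strahler_def Max_eq_iff)
qed

section \<open>Shapes as codes of full binary trees\<close>

lemma inj_vertices: "inj vertices"
proof (rule injI)
  show "vertices s = vertices t \<Longrightarrow> s = t" for s t
  proof (induction s arbitrary: t)
    case Tip
    then show ?case
      \<comment> \<open>The word \<open>[1]\<close> tells a \<open>Fork\<close> from a
        \<open>Tip\<close>.\<close>
      by (cases t) (auto simp: set_eq_iff dest!: spec [of _ "[1]"])
  next
    case (Fork a b)
    from Fork.prems obtain a' b' where t: "t = Fork a' b'"
      by (cases t) (auto simp: set_eq_iff dest!: spec [of _ "[1]"])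
    have "u \<in> vertices a \<longleftrightarrow> u \<in> vertices a'" "u \<in> vertices b \<longleftrightarrow> u \<in> vertices b'" for u
      using Fork.prems [unfolded set_eq_iff, rule_format, of "1 # u"]
        Fork.prems [unfolded set_eq_iff, rule_format, of "2 # u"] t by auto
    then show ?case
      using Fork.IH t by blast
  qed
qed

lemma binary_tree_full_vertices: "binary_tree (vertices t) \<and> full (vertices t)"
proof (induction t)
  case Tip
  then show ?case
    by (auto simp: binary_tree_def full_def words_def)
next
  case (Fork a b)
  have "binary_tree (join (vertices a) (vertices b))"
    unfolding binary_tree_def
  proof (intro conjI allI impI)
    show "join (vertices a) (vertices b) \<subseteq> words"
      using Fork by (auto simp: words_def binary_tree_def join_def subset_iff lists_eq_set, blast+)
    show "finite (join (vertices a) (vertices b))"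
      using Fork by (auto simp: binary_tree_def join_def)
    show "u \<in> join (vertices a) (vertices b)" if "u @ [x] \<in> join (vertices a) (vertices b)" for u x
      using Fork that by (cases u) (auto simp: binary_tree_def)
  qed simp
  moreover have "full (join (vertices a) (vertices b))"
    unfolding full_def
  proof
    show "u @ [1] \<in> join (vertices a) (vertices b) \<longleftrightarrow> u @ [2] \<in> join (vertices a) (vertices b)"
      if "u \<in> join (vertices a) (vertices b)" for u
      using that by (rule in_join_cases) (use Fork in \<open>auto simp: full_def\<close>)
  qed
  ultimately show ?case
    by simp
qed

lemma binary_tree_prefix: "binary_tree t \<Longrightarrow> u @ v \<in> t \<Longrightarrow> u \<in> t"
  by (induction v rule: rev_induct) (auto simp: binary_tree_def simp flip: append_assoc)

lemma full_binary_tree_branch: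
  assumes "binary_tree t" "full t" "[x] \<in> t"
  shows "binary_tree {u. x # u \<in> t}" "full {u. x # u \<in> t}"
proof -
  have "finite {u. x # u \<in> t}"
    using assms(1) finite_vimageI [of t "(#) x"] by (simp add: binary_tree_def vimage_def)
  then show "binary_tree {u. x # u \<in> t}"
    using assms unfolding binary_tree_def words_def
    by (auto simp: subset_iff lists_eq_set simp flip: append_Cons)
  show "full {u. x # u \<in> t}"
    using assms unfolding full_def by (auto simp flip: append_Cons)
qed

text \<open>Each branch has fewer vertices because the root is lost, and fullness gives both
  branches or none.\<close>

lemma vertices_surj: "binary_tree t \<Longrightarrow> full t \<Longrightarrow> t \<in> range vertices"
proof (induction "card t" arbitrary: t rule: less_induct)
  case less
  have fin: "finite t" and Nil: "[] \<in> t" and words: "t \<subseteq> words"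
    using less.prems by (auto simp: binary_tree_def)
  have prefix: "x # u \<in> t \<Longrightarrow> [x] \<in> t" for x u
    using binary_tree_prefix [OF less.prems(1), of "[x]" u] by simp
  have letter: "x = 1 \<or> x = 2" if "x # u \<in> t" for x u
    using that words by (auto simp: words_def)
  have 12: "[1] \<in> t \<longleftrightarrow> [2] \<in> t"
    using less.prems(2) Nil by (force simp: full_def)
  show ?case
  proof (cases "[1] \<in> t")
    case False
    have "t = {[]}"
    proof -
      have "u = []" if "u \<in> t" for u
        using that False 12 prefix letter by (cases u) auto
      with Nil show ?thesis
        by auto
    qed
    then show ?thesis
      by (metis rangeI vertices.simps(1))
  next
    case True
    have sub: "{u. x # u \<in> t} \<in> range vertices" if x: "[x] \<in> t" for x
    proof (rule less.hyps)
      have "card ((#) x ` {u. x # u \<in> t}) < card t"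
        by (rule psubset_card_mono [OF fin]) (use Nil in auto)
      then show "card {u. x # u \<in> t} < card t"
        by (simp add: card_image)
    qed (use full_binary_tree_branch less.prems x in auto)
    obtain a b where ab: "{u. 1 # u \<in> t} = vertices a" "{u. 2 # u \<in> t} = vertices b"
      using sub [of 1] sub [of 2] True 12 by auto
    have "w \<in> t \<longleftrightarrow> w \<in> vertices (Fork a b)" for w
      unfolding vertices.simps ab [symmetric] by (cases w) (use Nil letter in auto)
    then show ?thesis
      by blast
  qed
qed

text \<open>\<open>size\<close> counts the \<open>Fork\<close> nodes and is \<open>0\<close> on
  \<open>Tip\<close>. Finiteness is carried along for the cardinality of the disjoint union.\<close>

lemma internal_vertices: "finite {v. internal (vertices t) v} \<and> card {v. internal (vertices t) v} = size t"
proof (induction t)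
  case Tip
  then show ?case
    by (simp add: internal_def)
next
  case (Fork a b)
  let ?I = "\<lambda>t. {v. internal (vertices t) v}"
  have "w \<in> ?I (Fork a b) \<longleftrightarrow> w \<in> insert [] ((#) 1 ` ?I a \<union> (#) 2 ` ?I b)" for w
    by (cases w) (auto simp: internal_def)
  then have eq: "?I (Fork a b) = insert [] ((#) 1 ` ?I a \<union> (#) 2 ` ?I b)"
    by blast
  show ?case
    unfolding eq using Fork
    by (subst card.insert) (auto simp: card_image intro!: card_Un_disjoint [THEN trans])
qed

lemma card_full_binary_trees: "card (full_binary_trees n h) = card {t. size t = n \<and> hs t = h}"
proof -
  have "full_binary_trees n h = vertices ` {t. size t = n \<and> hs t = h}"
    unfolding full_binary_trees_def
    using vertices_surj binary_tree_full_vertices internal_vertices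
    by (fastforce simp: horton_strahler_vertices)
  then show ?thesis
    using inj_vertices by (simp add: card_image inj_on_subset)
qed

lemma finite_shapes: "finite {t :: shape. size t = n}"
proof -
  \<comment> \<open>The induction bounds the size instead of fixing it, since the subtrees of a
    \<open>Fork\<close> may have any smaller size.\<close>
  have "finite {t :: shape. size t \<le> n}"
  proof (induction n)
    case 0
    have "{t :: shape. size t \<le> 0} \<subseteq> {Tip}"
    proof
      show "t \<in> {Tip}" if "t \<in> {t. size t \<le> 0}" for t :: shape
        using that by (cases t) auto
    qed
    then show ?case
      using finite_subset by blast
  next
    case (Suc n)
    let ?A = "{t :: shape. size t \<le> n}"
    have "t \<in> insert Tip ((\<lambda>(a, b). Fork a b) ` (?A \<times> ?A))" if "size t \<le> Suc n" for t :: shape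
      using that by (cases t) auto
    then have "{t :: shape. size t \<le> Suc n} \<subseteq> insert Tip ((\<lambda>(a, b). Fork a b) ` (?A \<times> ?A))"
      by blast
    then show ?case
      using Suc finite_subset by blast
  qed
  then show ?thesis
    by (rule rev_finite_subset) auto
qed

section \<open>Generating functions of trees\<close>

definition gf :: "shape set \<Rightarrow> int fps" where
  "gf A = Abs_fps (\<lambda>n. int (card {t \<in> A. size t = n}))"

lemma finite_shapes_in: "finite {t \<in> A. size t = n}" for A :: "shape set"
  by (rule finite_subset [OF _ finite_shapes [of n]]) auto

lemma gf_Un:
  assumes "A \<inter> B = {}"
  shows "gf (A \<union> B) = gf A + gf B"
proof (rule fps_ext)
  fix n
  have "{t \<in> A \<union> B. size t = n} = {t \<in> A. size t = n} \<union> {t \<in> B. size t = n}"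
    by auto
  moreover have "card \<dots> = card {t \<in> A. size t = n} + card {t \<in> B. size t = n}"
    by (rule card_Un_disjoint) (use assms in \<open>auto simp: finite_shapes_in\<close>)
  ultimately show "gf (A \<union> B) $ n = (gf A + gf B) $ n"
    by (simp add: gf_def)
qed

lemma gf_Diff: "A \<subseteq> B \<Longrightarrow> gf (B - A) = gf B - gf A"
  using gf_Un [of "B - A" A] by (simp add: Diff_Int_distrib2 Un_absorb2 Int_commute)

lemma gf_Tip: "gf {Tip} = 1"
proof (rule fps_ext)
  fix n
  have "{t \<in> {Tip}. size t = n} = (if n = 0 then {Tip} else {})"
    by auto
  then show "gf {Tip} $ n = 1 $ n"
    by (simp add: gf_def)
qed

text \<open>The root contributes \<open>fps_X\<close>; the other \<open>n - 1\<close> forks are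
  distributed over the two branches, which is the Cauchy product.\<close>

lemma gf_Fork: "gf ((\<lambda>(a, b). Fork a b) ` (A \<times> B)) = fps_X * (gf A * gf B)"
proof (rule fps_ext)
  fix n
  let ?F = "\<lambda>(a, b). Fork a b"
  show "gf (?F ` (A \<times> B)) $ n = (fps_X * (gf A * gf B)) $ n"
  proof (cases n)
    case 0
    have "{t \<in> ?F ` (A \<times> B). size t = 0} = {}"
      by auto
    then have "card {t \<in> ?F ` (A \<times> B). size t = 0} = 0"
      by (simp only: card.empty)
    then show ?thesis
      using 0 by (simp add: gf_def)
  next
    case (Suc m)
    let ?P = "\<lambda>i. {t \<in> A. size t = i} \<times> {t \<in> B. size t = m - i}"
    have "{t \<in> ?F ` (A \<times> B). size t = n} = ?F ` (\<Union>i\<in>{0..m}. ?P i)"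
      using Suc by auto
    also have "card \<dots> = card (\<Union>i\<in>{0..m}. ?P i)"
      by (rule card_image) (auto simp: inj_on_def)
    also have "\<dots> = (\<Sum>i\<in>{0..m}. card (?P i))"
      by (rule card_UN_disjoint) (auto simp: finite_shapes_in)
    finally have "gf (?F ` (A \<times> B)) $ n = (gf A * gf B) $ m"
      by (simp add: gf_def fps_mult_nth card_cartesian_product)
    then show ?thesis
      using Suc by simp
  qed
qed

definition below :: "nat \<Rightarrow> shape set" where
  "below h = {t. hs t < h}"

text \<open>A \<open>Fork a b\<close> has number below \<open>h\<close> iff both branches do and
  \<open>hs a < p\<close> or \<open>hs b < q\<close>. Splitting on \<open>hs a < p\<close> makes the
  union disjoint, as \<open>gf_Un\<close> demands.\<close>

lemma below_decomp:
  assumes "h > 0" "p = h div 2" "q = (h - 1) div 2"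
  shows "below h = {Tip} \<union> ((\<lambda>(a, b). Fork a b) ` (below p \<times> below h) \<union>
    (\<lambda>(a, b). Fork a b) ` ((below h - below p) \<times> below q))"
proof -
  have "t \<in> below h \<longleftrightarrow> t \<in> {Tip} \<union> ((\<lambda>(a, b). Fork a b) ` (below p \<times> below h) \<union>
    (\<lambda>(a, b). Fork a b) ` ((below h - below p) \<times> below q))" for t
  proof (cases t)
    case Tip
    then show ?thesis
      using assms by (simp add: below_def)
  next
    case (Fork a b)
    have "t \<in> below h \<longleftrightarrow> hs a < h \<and> hs b < h \<and> (hs a < p \<or> hs b < q)"
      using assms Fork by (auto simp: below_def)
    then show ?thesis
      using Fork assms by (auto simp: below_def image_iff)
  qed
  then show ?thesis
    by blast
qed

lemma gf_below_rec:
  assumes "h > 0" "p = h div 2" "q = (h - 1) div 2"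
  shows "gf (below h) = 1 + fps_X * (gf (below p) * gf (below h) + (gf (below h) - gf (below p)) * gf (below q))"
proof -
  have sub: "below p \<subseteq> below h"
    using assms by (auto simp: below_def)
  show ?thesis
    apply (subst below_decomp [OF assms])
    apply (subst gf_Un)
     apply force
    apply (subst gf_Un)
     apply force
    apply (simp only: gf_Tip gf_Fork gf_Diff [OF sub] distrib_left)
    done
qed

section \<open>Fibonacci polynomials and the tree series\<close>

fun fib_fps :: "nat \<Rightarrow> int fps" where
  "fib_fps 0 = 0"
| "fib_fps (Suc 0) = 1"
| "fib_fps (Suc (Suc n)) = fib_fps (Suc n) - fps_X * fib_fps n"

text \<open>Moving one unit from \<open>q\<close> to \<open>p\<close> preserves the left side: by
  the recurrence, its values at \<open>(Suc p, q)\<close> and \<open>(p, Suc q)\<close>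
  agree.\<close>

lemma fib_fps_add:
  "fib_fps (Suc p) * fib_fps (Suc q) - fps_X * fib_fps p * fib_fps q = fib_fps (Suc (p + q))"
proof (induction p arbitrary: q)
  case (Suc p)
  show ?case
    using Suc [of "Suc q"] by (simp add: algebra_simps)
qed simp

lemma fib_fps_Suc_nonzero: "fib_fps (Suc n) \<noteq> 0"
proof -
  have "fib_fps (Suc n) $ 0 = 1"
    by (induction n) simp_all
  then show ?thesis
    by force
qed

lemma gf_below: "gf (below h) * fib_fps (Suc h) = fib_fps h"
proof (induction h rule: less_induct)
  case (less h)
  show ?case
  proof (cases "h = 0")
    case True
    then show ?thesis
      by (simp add: below_def gf_def fps_eq_iff)
  next
    case False
    define p q where "p = h div 2" and "q = (h - 1) div 2"
    define T P Q where "T = gf (below h)" "P = gf (below p)" "Q = gf (below q)"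
    define x p0 p1 q0 q1 where
      "x = (fps_X :: int fps)" "p0 = fib_fps p" "p1 = fib_fps (Suc p)" "q0 = fib_fps q" "q1 = fib_fps (Suc q)"
    note defs = p_def q_def T_P_Q_def x_p0_p1_q0_q1_def
    have pq: "h = Suc (p + q)" "p < h" "q < h"
      using False by (auto simp: defs)
    have P: "P * p1 = p0" and Q: "Q * q1 = q0"
      using less pq by (auto simp: T_P_Q_def x_p0_p1_q0_q1_def)
    have T: "T = 1 + x * (P * T + (T - P) * Q)"
      using gf_below_rec [of h p q] False by (simp add: defs)
    have h: "fib_fps h = p1 * q1 - x * p0 * q0"
      using fib_fps_add [of p q] pq by (simp add: x_p0_p1_q0_q1_def)
    have Sh: "fib_fps (Suc h) = (p1 - x * p0) * q1 - x * p1 * q0"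
      using fib_fps_add [of "Suc p" q] pq by (simp add: x_p0_p1_q0_q1_def)
    \<comment> \<open>The recursion reads \<open>T * (1 - x * P - x * Q) = 1 - x * P * Q\<close>.
      Multiplying by \<open>p1 * q1\<close>, with \<open>p0 = P * p1\<close> and
      \<open>q0 = Q * q1\<close>, gives the claim.\<close>
    have "T * fib_fps (Suc h) = fib_fps h"
      unfolding h Sh P [symmetric] Q [symmetric] using T by algebra
    then show ?thesis
      by (simp add: T_P_Q_def)
  qed
qed

section \<open>Walks below a given height\<close>

text \<open>Any endpoint \<open>j\<close> is allowed so that deleting the last step stays in the
  family; the codomain \<open>{..<h}\<close> encodes the height bound.\<close>

definition walks :: "nat \<Rightarrow> nat \<Rightarrow> nat \<Rightarrow> (nat \<Rightarrow> nat) set" where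
  "walks h k j = {d \<in> {0..k} \<rightarrow>\<^sub>E {..<h}. d 0 = 0 \<and> d k = j \<and>
     (\<forall>i\<in>{1..k}. \<bar>int (d i) - int (d (i - 1))\<bar> = 1)}"

lemma finite_walks: "finite (walks h k j)"
  by (rule finite_subset [of _ "{0..k} \<rightarrow>\<^sub>E {..<h}"]) (auto simp: walks_def intro: finite_PiE)

lemma walks_upd:
  assumes "d \<in> walks h k i" "\<bar>int j - int i\<bar> = 1" "j < h"
  shows "d(Suc k := j) \<in> walks h (Suc k) j"
  using assms by (auto simp: walks_def PiE_iff extensional_def atLeastAtMostSuc_conv)

lemma walks_restrict:
  assumes "d \<in> walks h (Suc k) j"
  shows "restrict d {0..k} \<in> walks h k (d k)" "\<bar>int j - int (d k)\<bar> = 1"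
    "d = (restrict d {0..k})(Suc k := j)"
proof -
  show "restrict d {0..k} \<in> walks h k (d k)" "\<bar>int j - int (d k)\<bar> = 1"
    using assms by (auto simp: walks_def PiE_iff atLeastAtMostSuc_conv)
  show "d = (restrict d {0..k})(Suc k := j)"
    using assms by (auto simp: walks_def PiE_iff extensional_def fun_eq_iff)
qed

lemma card_walks_Suc:
  assumes "j < h"
  shows "card (walks h (Suc k) j) =
    card (walks h k (Suc j)) + (if j = 0 then 0 else card (walks h k (j - 1)))"
proof -
  let ?U = "walks h k (Suc j) \<union> (if j = 0 then {} else walks h k (j - 1))"
  have "walks h (Suc k) j = (\<lambda>d. d(Suc k := j)) ` ?U"
  proof (intro equalityI subsetI)
    fix d assume d: "d \<in> walks h (Suc k) j"
    have "d k = Suc j \<or> j \<noteq> 0 \<and> d k = j - 1"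
      using walks_restrict(2) [OF d] by auto
    then have "restrict d {0..k} \<in> ?U"
      using walks_restrict(1) [OF d] by auto
    then show "d \<in> (\<lambda>d. d(Suc k := j)) ` ?U"
      using walks_restrict(3) [OF d] by (intro rev_image_eqI)
  next
    fix d assume "d \<in> (\<lambda>d. d(Suc k := j)) ` ?U"
    then show "d \<in> walks h (Suc k) j"
      using assms by (auto intro!: walks_upd split: if_splits)
  qed
  moreover have "inj_on (\<lambda>d. d(Suc k := j)) ?U"
  proof (rule inj_onI)
    fix d e assume "d \<in> ?U" "e \<in> ?U" and eq: "d(Suc k := j) = e(Suc k := j)"
    \<comment> \<open>Extensionality makes both functions \<open>undefined\<close> at
      \<open>Suc k\<close>, so the overwritten value is known.\<close>
    then have "d (Suc k) = e (Suc k)"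
      by (auto simp: walks_def PiE_iff extensional_def split: if_splits)
    with eq show "d = e"
      by (metis fun_upd_triv fun_upd_upd)
  qed
  moreover have "card ?U = card (walks h k (Suc j)) + card (if j = 0 then {} else walks h k (j - 1))"
    by (rule card_Un_disjoint) (auto simp: finite_walks, auto simp: walks_def)
  ultimately show ?thesis
    by (simp add: card_image)
qed

lemma walks_0: "walks h 0 j = (if j = 0 \<and> h > 0 then {\<lambda>i. if i = 0 then 0 else undefined} else {})"
  by (auto simp: walks_def PiE_iff extensional_def fun_eq_iff)

text \<open>Levels from \<open>h\<close> on are forbidden, and a step climbs by at most one. For the
  second, both possible predecessors of an endpoint out of reach are again out of reach.\<close>

lemma walks_empty: "h \<le> j \<or> k < j \<Longrightarrow> walks h k j = {}"
proof (induction k arbitrary: j)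
  case 0
  then show ?case
    by (auto simp: walks_0)
next
  case (Suc k)
  show ?case
  proof (cases "h \<le> j")
    case True
    then show ?thesis
      unfolding walks_def PiE_iff by (auto intro!: bexI [of _ "Suc k"])
  next
    case False
    with Suc.prems have "walks h k (Suc j) = {}" "walks h k (j - 1) = {}"
      by (auto intro!: Suc.IH)
    then have "card (walks h (Suc k) j) = 0"
      using False by (subst card_walks_Suc) auto
    then show ?thesis
      by (simp add: finite_walks)
  qed
qed

text \<open>A walk from \<open>0\<close> to \<open>j\<close> has length \<open>2 * n + j\<close>, where \<open>n\<close> counts its down-steps.\<close>

definition walk_gf :: "nat \<Rightarrow> nat \<Rightarrow> int fps" where
  "walk_gf h j = Abs_fps (\<lambda>n. int (card (walks h (2 * n + j) j)))"

lemma walk_gf_0: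
  assumes "h > 0"
  shows "walk_gf h 0 = 1 + fps_X * walk_gf h 1"
proof (rule fps_ext)
  show "walk_gf h 0 $ n = (1 + fps_X * walk_gf h 1) $ n" for n
    using assms by (cases n) (auto simp: walk_gf_def walks_0 card_walks_Suc)
qed

text \<open>A last step up from \<open>j\<close> keeps the number of down-steps; a last step down
  from \<open>j + 2\<close> lowers it by one, hence \<open>fps_X\<close>. At \<open>n = 0\<close>
  the latter is impossible, as length \<open>j\<close> does not reach \<open>j + 2\<close>.\<close>

lemma walk_gf_Suc:
  assumes "Suc j < h"
  shows "walk_gf h (Suc j) = walk_gf h j + fps_X * walk_gf h (Suc (Suc j))"
proof (rule fps_ext)
  show "walk_gf h (Suc j) $ n = (walk_gf h j + fps_X * walk_gf h (Suc (Suc j))) $ n" for n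
    using assms by (cases n) (auto simp: walk_gf_def card_walks_Suc walks_empty)
qed

lemma walk_gf_ge: "h \<le> j \<Longrightarrow> walk_gf h j = 0"
  by (simp add: walk_gf_def walks_empty fps_eq_iff)

text \<open>The induction descends from the top level, \<open>i\<close> counting the levels from
  \<open>Suc j\<close> to \<open>h - 1\<close>. At \<open>i = 0\<close> both
  \<open>walk_gf h h\<close> and \<open>fib_fps 0\<close> vanish; below, the two recurrences
  match.\<close>

lemma walk_gf_ratio:
  "Suc j + i = h \<Longrightarrow> walk_gf h (Suc j) * fib_fps (Suc i) = walk_gf h j * fib_fps i"
proof (induction i arbitrary: j)
  case 0
  then show ?case
    by (simp add: walk_gf_ge)
next
  case (Suc i)
  have "walk_gf h (Suc j) * fib_fps (Suc i) =
      walk_gf h j * fib_fps (Suc i) + fps_X * (walk_gf h (Suc (Suc j)) * fib_fps (Suc i))"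
    using Suc.prems by (subst walk_gf_Suc) (auto simp: algebra_simps)
  also have "walk_gf h (Suc (Suc j)) * fib_fps (Suc i) = walk_gf h (Suc j) * fib_fps i"
    using Suc by simp
  finally show ?case
    by (simp add: algebra_simps)
qed

lemma walk_gf_fib: "walk_gf h 0 * fib_fps (Suc h) = fib_fps h"
proof (cases h)
  case 0
  then show ?thesis
    by (simp add: walk_gf_ge)
next
  case (Suc i)
  have "walk_gf h 0 * fib_fps (Suc i) = fib_fps (Suc i) + fps_X * (walk_gf h (Suc 0) * fib_fps (Suc i))"
    using Suc by (subst walk_gf_0) (auto simp: algebra_simps)
  also have "walk_gf h (Suc 0) * fib_fps (Suc i) = walk_gf h 0 * fib_fps i"
    using Suc by (intro walk_gf_ratio) simp
  finally show ?thesis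
    using Suc by (simp add: algebra_simps)
qed

section \<open>Comparison of trees and Dyck paths\<close>

lemma card_below_eq_card_walks: "card {t. size t = n \<and> hs t < h} = card (walks h (2 * n) 0)"
proof -
  \<comment> \<open>Both series become \<open>fib_fps h\<close> when multiplied by the nonzero
    \<open>fib_fps (Suc h)\<close>, and integer power series form an integral domain.\<close>
  have "gf (below h) = walk_gf h 0"
    using gf_below [of h] walk_gf_fib [of h] fib_fps_Suc_nonzero [of h]
    by (metis mult_right_cancel)
  then have "gf (below h) $ n = walk_gf h 0 $ n"
    by simp
  moreover have "{t \<in> below h. size t = n} = {t. size t = n \<and> hs t < h}"
    by (auto simp: below_def)
  ultimately show ?thesis
    by (simp add: gf_def walk_gf_def)
qed

lemma walks_eq_dyck: "walks h (2 * n) 0 = {d. dyck_path n d \<and> height n d < h}"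
proof -
  have "height n d < h \<longleftrightarrow> (\<forall>i\<in>{0..2 * n}. d i < h)" for d
    unfolding height_def by (subst Max_less_iff) auto
  then show ?thesis
    by (auto simp: walks_def dyck_path_def PiE_iff)
qed

text \<open>Used for trees and for paths alike. The sets are finite and nested, so the truncated
  subtraction is exact.\<close>

lemma card_level:
  fixes f :: "'a \<Rightarrow> nat"
  assumes "finite {x. P x \<and> f x < Suc h}"
  shows "card {x. P x \<and> f x = h} = card {x. P x \<and> f x < Suc h} - card {x. P x \<and> f x < h}"
proof -
  have "{x. P x \<and> f x = h} = {x. P x \<and> f x < Suc h} - {x. P x \<and> f x < h}"
    by auto
  moreover have "finite {x. P x \<and> f x < h}"
    by (rule finite_subset [OF _ assms]) auto
  ultimately show ?thesis
    by (simp add: card_Diff_subset Collect_mono)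
qed

theorem theorem1p1:
  fixes n h :: nat
  shows "card (full_binary_trees n h) = card (dyck_paths n h)"
proof -
  have "card (full_binary_trees n h) =
      card {t. size t = n \<and> hs t < Suc h} - card {t. size t = n \<and> hs t < h}"
    unfolding card_full_binary_trees
    by (rule card_level) (rule finite_subset [OF _ finite_shapes [of n]], auto)
  also have "\<dots> = card (walks (Suc h) (2 * n) 0) - card (walks h (2 * n) 0)"
    by (simp only: card_below_eq_card_walks)
  also have "\<dots> = card (dyck_paths n h)"
    using card_level [of "dyck_path n" "height n" h] finite_walks [of "Suc h" "2 * n" 0]
    by (simp only: walks_eq_dyck dyck_paths_def)
  finally show ?thesis .
qed

end
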